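(* Let $f:\mathbb{R}\to\mathbb{R}$ be of class $C^1$, and let $r(u,t)$, $u\in\mathbb{S}^2$, evolve under the flow $r_t=f(r)$, where $r(\cdot,0)$ is a $C^3$ Morse–Smale function. Let $\mathcal{M}$ be the Morse–Smale complex on $\mathbb{S}^2$ defined by the gradient flow of the Euclidean distance function $u\mapsto r(u,t)$. Then $\mathcal{M}$ does not change in time.
   Context: The flow $r_t=f(r)$ means that for each fixed $u\in\mathbb{S}^2$ the function $t\mapsto r(u,t)$ solves $r_t(u,t)=f(r(u,t))$; $t$ ranges over a time interval containing $0$ on which the solution exists for every $u$. Here $r(u,t)$ is the distance of the evolving surface from the origin in direction $u$. The Morse–Smale complex of $r(\cdot,t)$ is the decomposition of $\mathbb{S}^2$ into the critical points, and the connected components of the intersections of stable and unstable manifolds of critical points, of the gradient flow of $r(\cdot,t)$ (gradient in $u$ with respect to the round metric of $\mathbb{S}^2$), i.e. cells consisting of integral curves having the same origin and destination. *)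

theory Defs
  imports "HOL-Analysis.Analysis"
begin

abbreviation S2 :: "(real^3) set" where
  "S2 \<equiv> sphere 0 1"

definition tangent_plane :: "real^3 \<Rightarrow> (real^3) set" where
  "tangent_plane u = {v. v \<bullet> u = 0}"

(* Functions on the sphere are total functions of which only the values on S2 matter.
   Calculus on the sphere is done with the extension that is constant along rays
   (sgn x = x / norm x; the origin is irrelevant). *)
definition radial_ext :: "(real^3 \<Rightarrow> real) \<Rightarrow> real^3 \<Rightarrow> real" where
  "radial_ext g x = g (sgn x)"

(* For open S in a finite-dimensional space this is the usual notion of class C^k. *)
primrec Ck_on ::
  "nat \<Rightarrow> ('a::euclidean_space \<Rightarrow> 'b::real_normed_vector) \<Rightarrow> 'a set \<Rightarrow> bool" where
  "Ck_on 0 f S \<longleftrightarrow> continuous_on S f"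
| "Ck_on (Suc k) f S \<longleftrightarrow>
     (\<forall>x\<in>S. f differentiable (at x)) \<and>
     (\<forall>v. Ck_on k (\<lambda>x. frechet_derivative f (at x) v) S)"

definition sphere_Ck :: "nat \<Rightarrow> (real^3 \<Rightarrow> real) \<Rightarrow> bool" where
  "sphere_Ck k g \<longleftrightarrow> Ck_on k (radial_ext g) (- {0})"

(* The radial extension is constant along rays, so its Euclidean gradient at a point u of
   S2 is tangent to S2, and it is the gradient of g at u for the round metric.
   The relational form includes differentiability of g at u. *)
definition has_sphere_gradient :: "(real^3 \<Rightarrow> real) \<Rightarrow> real^3 \<Rightarrow> real^3 \<Rightarrow> bool" where
  "has_sphere_gradient g u w \<longleftrightarrow> u \<in> S2 \<and> (GDERIV (radial_ext g) u :> w)"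

definition critical_points :: "(real^3 \<Rightarrow> real) \<Rightarrow> (real^3) set" where
  "critical_points g = {p \<in> S2. has_sphere_gradient g p 0}"

(* At a critical point p and for tangent vectors v, w this is the Hessian of g:
   the differential of the radial extension vanishes at p. *)
definition hessian :: "(real^3 \<Rightarrow> real) \<Rightarrow> real^3 \<Rightarrow> real^3 \<Rightarrow> real^3 \<Rightarrow> real" where
  "hessian g p v w =
     frechet_derivative (\<lambda>x. frechet_derivative (radial_ext g) (at x) v) (at p) w"

definition nondegenerate :: "(real^3 \<Rightarrow> real) \<Rightarrow> real^3 \<Rightarrow> bool" where
  "nondegenerate g p \<longleftrightarrow>
     (\<forall>v\<in>tangent_plane p. v \<noteq> 0 \<longrightarrow> (\<exists>w\<in>tangent_plane p. hessian g p v w \<noteq> 0))"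

(* Integral curves ascend from their origin (time -infinity) to their destination
   (time +infinity); S2 is compact, so they are taken to be defined for all times. *)
definition integral_curve :: "(real^3 \<Rightarrow> real) \<Rightarrow> (real \<Rightarrow> real^3) \<Rightarrow> bool" where
  "integral_curve g \<gamma> \<longleftrightarrow>
     (\<forall>s. \<gamma> s \<in> S2 \<and>
          (\<exists>w. has_sphere_gradient g (\<gamma> s) w \<and> (\<gamma> has_vector_derivative w) (at s)))"

definition stable_manifold :: "(real^3 \<Rightarrow> real) \<Rightarrow> real^3 \<Rightarrow> (real^3) set" where
  "stable_manifold g p = {x. \<exists>\<gamma>. integral_curve g \<gamma> \<and> \<gamma> 0 = x \<and> (\<gamma> \<longlongrightarrow> p) at_top}"

definition unstable_manifold :: "(real^3 \<Rightarrow> real) \<Rightarrow> real^3 \<Rightarrow> (real^3) set" where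
  "unstable_manifold g p = {x. \<exists>\<gamma>. integral_curve g \<gamma> \<and> \<gamma> 0 = x \<and> (\<gamma> \<longlongrightarrow> p) at_bot}"

(* Velocities at x of C^1 curves in W; for an embedded C^1 submanifold W this is the tangent
   space. It is used for stable and unstable manifolds of Morse functions, which are embedded. *)
definition tangent_space :: "(real^3) set \<Rightarrow> real^3 \<Rightarrow> (real^3) set" where
  "tangent_space W x =
     {v. \<exists>c e. e > 0 \<and> c C1_differentiable_on {-e<..<e} \<and> c ` {-e<..<e} \<subseteq> W \<and>
               c 0 = x \<and> (c has_vector_derivative v) (at 0)}"

definition transversal :: "(real^3) set \<Rightarrow> (real^3) set \<Rightarrow> bool" where
  "transversal V W \<longleftrightarrow>
     (\<forall>x\<in>V \<inter> W. {v + w | v w. v \<in> tangent_space V x \<and> w \<in> tangent_space W x} = tangent_plane x)"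

definition morse :: "(real^3 \<Rightarrow> real) \<Rightarrow> bool" where
  "morse g \<longleftrightarrow> (\<forall>p\<in>critical_points g. nondegenerate g p)"

definition morse_smale :: "(real^3 \<Rightarrow> real) \<Rightarrow> bool" where
  "morse_smale g \<longleftrightarrow> morse g \<and>
     (\<forall>p\<in>critical_points g. \<forall>q\<in>critical_points g.
        transversal (unstable_manifold g p) (stable_manifold g q))"

definition morse_smale_complex :: "(real^3 \<Rightarrow> real) \<Rightarrow> (real^3) set set" where
  "morse_smale_complex g =
     {{p} | p. p \<in> critical_points g} \<union>
     (\<Union>p\<in>critical_points g. \<Union>q\<in>critical_points g.
        components (unstable_manifold g p \<inter> stable_manifold g q))"

end

theory Submission
  imports Defs
begin

text \<open>
  All directions \<open>u\<close> obey the same scalar equation, so \<open>r(\<cdot>, t)\<close> arises from \<open>r(\<cdot>, 0)\<close> by composition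
  with the flow map of \<open>f\<close>, which is \<open>C\<^sup>1\<close> with positive derivative. The gradients at time
  \<open>t\<close> and at time \<open>0\<close> are therefore positive multiples of each other; the two gradient flows have
  the same critical points and the same oriented orbits, hence the same stable and unstable
  manifolds, and the complex is built from these alone.

  The argument below uses the flow map only through differences of solutions. Write
  \<open>f a - f b = (a - b) * q (a, b)\<close> with \<open>q\<close> continuous. The difference of two solutions then satisfies
  a linear equation, which gives the exact formula
  \<open>r u t - r v t = (r u 0 - r v 0) * E (u, v)\<close>, with \<open>E\<close> the exponential of an integral of \<open>q\<close>
  (\<open>flow_difference_factor\<close>). This one formula yields uniqueness of solutions, preservation of
  their order, and, since \<open>E\<close> is positive and continuous, the rule that the gradient at \<open>u\<close> is
  multiplied by \<open>E (u, u)\<close> (\<open>has_sphere_gradient_scaled\<close>). It is symmetric under exchanging the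
  two times, with \<open>1 / E\<close> in place of \<open>E\<close>.

  An integral curve of a gradient becomes, after a change of time, an integral curve of a positive
  multiple of it. Compactness of the sphere bounds the multiplier from above, and so the new time
  runs through the whole real line and origins and destinations are kept
  (\<open>integral_curve_time_change\<close>).
\<close>

section \<open>Flows of autonomous scalar equations\<close>

text \<open>
  The integral \<open>\<integral> f' (b + \<theta> (a - b)) d\<theta>\<close> over \<open>[0, 1]\<close> is the difference quotient off the diagonal and
  \<open>f'\<close> on it; in this form its joint continuity is evident.
\<close>
lemma C1_divided_difference:
  fixes f :: "real \<Rightarrow> real"
  assumes "f C1_differentiable_on UNIV"
  obtains q where "continuous_on UNIV q" "\<And>a b. f a - f b = (a - b) * q (a, b)"
proof -
  obtain D where D: "\<And>x. (f has_vector_derivative D x) (at x)" and contD: "continuous_on UNIV D"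
    using assms unfolding C1_differentiable_on_def by auto
  define q where "q = (\<lambda>p::real \<times> real. integral (cbox 0 1) (\<lambda>\<theta>. D (snd p + \<theta> * (fst p - snd p))))"
  have "continuous_on UNIV q"
    unfolding q_def
    by (rule integral_continuous_on_param)
       (auto simp: split_beta intro!: continuous_on_compose2[OF contD] continuous_intros)
  moreover have "f a - f b = (a - b) * q (a, b)" for a b
  proof -
    have "((\<lambda>\<theta>. (a - b) * D (b + \<theta> * (a - b))) has_integral
            f (b + 1 * (a - b)) - f (b + 0 * (a - b))) {0..1}"
    proof (rule fundamental_theorem_of_calculus)
      fix \<theta> :: real
      have "((\<lambda>\<theta>. b + \<theta> * (a - b)) has_vector_derivative (a - b)) (at \<theta> within {0..1})"
        by (auto intro!: derivative_eq_intros)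
      from vector_diff_chain_within[OF this has_vector_derivative_at_within[OF D]]
      show "((\<lambda>\<theta>. f (b + \<theta> * (a - b))) has_vector_derivative (a - b) * D (b + \<theta> * (a - b)))
              (at \<theta> within {0..1})"
        by (simp add: o_def)
    qed simp
    from integral_unique[OF this] show ?thesis
      by (simp add: q_def)
  qed
  ultimately show thesis
    using that by blast
qed

text \<open>
  The difference \<open>d = x - y\<close> solves the linear equation \<open>d' = q (x, y) d\<close>. In particular
  solutions never cross.
\<close>
lemma solution_difference:
  fixes f x y :: "real \<Rightarrow> real"
  assumes q: "continuous_on UNIV q" "\<And>a b. f a - f b = (a - b) * q (a, b)"
    and x: "\<And>s. s \<in> {0..t} \<Longrightarrow> (x has_real_derivative f (x s)) (at s within {0..t})"
    and y: "\<And>s. s \<in> {0..t} \<Longrightarrow> (y has_real_derivative f (y s)) (at s within {0..t})"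
    and s: "s \<in> {0..t}"
  shows "x s - y s = (x 0 - y 0) * exp (integral {0..s} (\<lambda>\<sigma>. q (x \<sigma>, y \<sigma>)))"
proof -
  define I where "I = (\<lambda>s. integral {0..s} (\<lambda>\<sigma>. q (x \<sigma>, y \<sigma>)))"
  have "continuous_on {0..t} x" "continuous_on {0..t} y"
    by (rule DERIV_continuous_on, erule x y)+
  then have "continuous_on {0..t} (\<lambda>\<sigma>. q (x \<sigma>, y \<sigma>))"
    by (intro continuous_on_compose2[OF q(1)] continuous_intros) auto
  then have I: "(I has_real_derivative q (x s, y s)) (at s within {0..t})" if "s \<in> {0..t}" for s
    unfolding I_def using integral_has_real_derivative that by blast
  have "((\<lambda>s. (x s - y s) * exp (- I s)) has_real_derivative 0) (at s within {0..t})"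
    if "s \<in> {0..t}" for s
  proof -
    have "((\<lambda>s. (x s - y s) * exp (- I s)) has_real_derivative
            (f (x s) - f (y s)) * exp (- I s) - (x s - y s) * q (x s, y s) * exp (- I s))
          (at s within {0..t})"
      by (rule derivative_eq_intros x y I that refl | simp add: algebra_simps)+
    then show ?thesis
      by (simp add: q(2))
  qed
  then have "\<exists>c. \<forall>s\<in>{0..t}. (x s - y s) * exp (- I s) = c"
    by (intro has_field_derivative_zero_constant) auto
  then obtain c where c: "\<And>s. s \<in> {0..t} \<Longrightarrow> (x s - y s) * exp (- I s) = c"
    by blast
  have "0 \<in> {0..t}" "I 0 = 0"
    using s by (auto simp: I_def)
  then have "x 0 - y 0 = (x s - y s) * exp (- I s)"
    using c[OF s] c[of 0] by simp
  also have "\<dots> * exp (I s) = x s - y s"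
    by (simp add: mult.assoc flip: exp_add)
  finally show ?thesis
    by (simp add: I_def)
qed

text \<open>
  Solutions keep the order of their initial values, so those starting at the minimum and the
  maximum of the initial function enclose all others up to time \<open>t\<close>. On the resulting bounded range
  \<open>q\<close> is bounded, and \<open>solution_difference\<close> becomes a Lipschitz estimate in the initial value that
  is uniform in time.
\<close>
lemma flow_jointly_continuous:
  fixes r :: "'a::metric_space \<Rightarrow> real \<Rightarrow> real"
  assumes q: "continuous_on UNIV q" "\<And>a b. f a - f b = (a - b) * q (a, b)"
    and X: "compact X" and r0: "continuous_on X (\<lambda>u. r u 0)"
    and flow: "\<And>u s. u \<in> X \<Longrightarrow> s \<in> {0..t} \<Longrightarrow>
                 (r u has_real_derivative f (r u s)) (at s within {0..t})"
  shows "continuous_on (X \<times> {0..t}) (\<lambda>(u, s). r u s)"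
proof (cases "X = {}")
  case False
  obtain lo hi where lo: "lo \<in> X" "\<And>u. u \<in> X \<Longrightarrow> r lo 0 \<le> r u 0"
    and hi: "hi \<in> X" "\<And>u. u \<in> X \<Longrightarrow> r u 0 \<le> r hi 0"
    using continuous_attains_inf[OF X False r0] continuous_attains_sup[OF X False r0] by blast
  have diff: "r u s - r v s = (r u 0 - r v 0) * exp (integral {0..s} (\<lambda>\<sigma>. q (r u \<sigma>, r v \<sigma>)))"
    if "u \<in> X" "v \<in> X" "s \<in> {0..t}" for u v s
    using that by (intro solution_difference[OF q]) (auto intro: flow)
  have ordered: "r u s \<le> r v s" if "u \<in> X" "v \<in> X" "s \<in> {0..t}" "r u 0 \<le> r v 0" for u v s
  proof -
    have "r u s - r v s \<le> 0"
      using that by (subst diff) (auto intro: mult_nonpos_nonneg)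
    then show ?thesis by simp
  qed
  have cont: "continuous_on {0..t} (r u)" if "u \<in> X" for u
    by (rule DERIV_continuous_on) (rule flow[OF that])
  have "bounded (r lo ` {0..t} \<union> r hi ` {0..t})"
    by (intro bounded_Un[THEN iffD2] conjI compact_imp_bounded compact_continuous_image cont lo hi
        compact_Icc)
  then obtain B where "\<forall>a \<in> r lo ` {0..t} \<union> r hi ` {0..t}. norm a \<le> B"
    unfolding bounded_iff by blast
  then have B: "\<bar>r lo s\<bar> \<le> B \<and> \<bar>r hi s\<bar> \<le> B" if "s \<in> {0..t}" for s
    using that by simp
  have range: "r u s \<in> {-B..B}" if "u \<in> X" "s \<in> {0..t}" for u s
    using ordered[OF lo(1) that lo(2)] ordered[OF that(1) hi(1) that(2) hi(2)] that B[OF that(2)]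
    by (simp add: abs_le_iff)
  have "compact (q ` ({-B..B} \<times> {-B..B}))"
    by (intro compact_continuous_image continuous_on_subset[OF q(1)] compact_Times) auto
  then have "bounded (q ` ({-B..B} \<times> {-B..B}))"
    by (rule compact_imp_bounded)
  then obtain L where "\<forall>x\<in>q ` ({-B..B} \<times> {-B..B}). norm x \<le> L"
    unfolding bounded_iff by blast
  then have L: "q (a, b) \<le> \<bar>L\<bar>" if "a \<in> {-B..B}" "b \<in> {-B..B}" for a b
  proof -
    have "q (a, b) \<in> q ` ({-B..B} \<times> {-B..B})"
      using that by blast
    then have "norm (q (a, b)) \<le> L"
      using \<open>\<forall>x\<in>_. norm x \<le> L\<close> by blast
    then show ?thesis
      by simp
  qed
  define C where "C = exp (\<bar>L\<bar> * t)"
  have lip: "\<bar>r u s - r v s\<bar> \<le> C * \<bar>r u 0 - r v 0\<bar>"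
    if uv: "u \<in> X" "v \<in> X" "s \<in> {0..t}" for u v s
  proof -
    have qc: "continuous_on {0..s} (\<lambda>\<sigma>. q (r u \<sigma>, r v \<sigma>))"
      using uv by (intro continuous_on_compose2[OF q(1)] continuous_intros
            continuous_on_subset[OF cont]) auto
    have "integral {0..s} (\<lambda>\<sigma>. q (r u \<sigma>, r v \<sigma>)) \<le> integral {0..s} (\<lambda>\<sigma>. \<bar>L\<bar>)"
    proof (rule integral_le)
      show "q (r u \<sigma>, r v \<sigma>) \<le> \<bar>L\<bar>" if "\<sigma> \<in> {0..s}" for \<sigma>
        using L[OF range range, of u \<sigma> v \<sigma>] uv that by auto
    qed (use qc in \<open>auto intro: integrable_continuous_interval\<close>)
    also have "\<dots> \<le> \<bar>L\<bar> * t"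
      using uv by (auto simp: mult.commute intro: mult_right_mono)
    finally have "exp (integral {0..s} (\<lambda>\<sigma>. q (r u \<sigma>, r v \<sigma>))) \<le> C"
      by (simp add: C_def)
    then show ?thesis
      using mult_right_mono[of _ C "\<bar>r u 0 - r v 0\<bar>"]
      unfolding diff[OF uv] abs_mult by (simp add: mult.commute[of "\<bar>r u 0 - r v 0\<bar>"])
  qed
  show ?thesis
    unfolding continuous_on_def
  proof safe
    fix u s assume u: "u \<in> X" and s: "s \<in> {0..t}"
    let ?F = "at (u, s) within X \<times> {0..t}"
    have "continuous_on (X \<times> {0..t}) (\<lambda>p. r (fst p) 0)"
      by (rule continuous_on_compose2[OF r0]) (auto intro!: continuous_intros)
    then have space: "((\<lambda>p. r (fst p) 0) \<longlongrightarrow> r u 0) ?F"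
      using u s by (fastforce simp: continuous_on_def)
    have "continuous_on (X \<times> {0..t}) (\<lambda>p. r u (snd p))"
      by (rule continuous_on_compose2[OF cont[OF u]]) (auto intro!: continuous_intros)
    then have time: "((\<lambda>p. r u (snd p)) \<longlongrightarrow> r u s) ?F"
      using u s by (fastforce simp: continuous_on_def)
    have "((\<lambda>p. r (fst p) (snd p) - r u s) \<longlongrightarrow> 0) ?F"
    proof (rule Lim_null_comparison)
      show "\<forall>\<^sub>F p in ?F. norm (r (fst p) (snd p) - r u s)
              \<le> C * \<bar>r (fst p) 0 - r u 0\<bar> + \<bar>r u (snd p) - r u s\<bar>"
        unfolding eventually_at_filter
      proof (intro always_eventually allI impI)
        fix p assume "p \<in> X \<times> {0..t}"
        then show "norm (r (fst p) (snd p) - r u s)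
              \<le> C * \<bar>r (fst p) 0 - r u 0\<bar> + \<bar>r u (snd p) - r u s\<bar>"
          using lip[of "fst p" u "snd p"] u by auto
      qed
      show "((\<lambda>p. C * \<bar>r (fst p) 0 - r u 0\<bar> + \<bar>r u (snd p) - r u s\<bar>) \<longlongrightarrow> 0) ?F"
        by (rule tendsto_eq_intros space time refl | simp)+
    qed
    then show "((\<lambda>(u, s). r u s) \<longlongrightarrow> r u s) ?F"
      by (simp add: LIM_zero_iff case_prod_beta')
  qed
qed simp

text \<open>
  Joint continuity of \<open>r\<close> makes the integral in the exponent of \<open>solution_difference\<close> continuous in
  the pair \<open>(u, v)\<close>.
\<close>
lemma flow_difference_factor_forward:
  fixes r :: "'a::metric_space \<Rightarrow> real \<Rightarrow> real" and f :: "real \<Rightarrow> real"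
  assumes f: "f C1_differentiable_on UNIV"
    and X: "compact X" and r0: "continuous_on X (\<lambda>u. r u 0)" and t: "0 \<le> t"
    and flow: "\<And>u s. u \<in> X \<Longrightarrow> s \<in> {0..t} \<Longrightarrow>
                 (r u has_real_derivative f (r u s)) (at s within {0..t})"
  obtains E where "continuous_on (X \<times> X) E" "\<And>u v. 0 < E (u, v)"
    "\<And>u v. u \<in> X \<Longrightarrow> v \<in> X \<Longrightarrow> r u t - r v t = (r u 0 - r v 0) * E (u, v)"
proof -
  obtain q where q: "continuous_on UNIV q" "\<And>a b. f a - f b = (a - b) * q (a, b)"
    using C1_divided_difference[OF f] by blast
  have cont: "continuous_on (X \<times> {0..t}) (\<lambda>(u, s). r u s)"
    by (rule flow_jointly_continuous[OF q X r0 flow])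
  define E where "E = (\<lambda>p. exp (integral (cbox 0 t) (\<lambda>\<sigma>. q (r (fst p) \<sigma>, r (snd p) \<sigma>))))"
  have "continuous_on ((X \<times> X) \<times> cbox 0 t) (\<lambda>(p, \<sigma>). q (r (fst p) \<sigma>, r (snd p) \<sigma>))"
    unfolding split_beta
  proof (intro continuous_on_compose2[OF q(1)] continuous_on_Pair)
    show "continuous_on ((X \<times> X) \<times> cbox 0 t) (\<lambda>x. r (fst (fst x)) (snd x))"
      by (rule continuous_on_compose2[OF cont, where f = "\<lambda>x. (fst (fst x), snd x)", simplified])
         (auto intro!: continuous_intros)
    show "continuous_on ((X \<times> X) \<times> cbox 0 t) (\<lambda>x. r (snd (fst x)) (snd x))"
      by (rule continuous_on_compose2[OF cont, where f = "\<lambda>x. (snd (fst x), snd x)", simplified])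
         (auto intro!: continuous_intros)
  qed auto
  then have "continuous_on (X \<times> X) E"
    unfolding E_def by (intro continuous_on_exp integral_continuous_on_param)
  moreover have "r u t - r v t = (r u 0 - r v 0) * E (u, v)" if "u \<in> X" "v \<in> X" for u v
    using solution_difference[OF q flow[OF that(1)] flow[OF that(2)], of t] t by (simp add: E_def)
  ultimately show thesis
    using that[of E] by (simp add: E_def)
qed

text \<open>
  For negative \<open>t\<close> time is reversed: \<open>s \<mapsto> r u (- s)\<close> solves the equation for \<open>- f\<close>.
\<close>
lemma flow_difference_factor:
  fixes r :: "'a::metric_space \<Rightarrow> real \<Rightarrow> real" and f :: "real \<Rightarrow> real"
  assumes f: "f C1_differentiable_on UNIV"
    and X: "compact X" and r0: "continuous_on X (\<lambda>u. r u 0)"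
    and T: "is_interval T" "0 \<in> T" "t \<in> T"
    and flow: "\<And>u s. u \<in> X \<Longrightarrow> s \<in> T \<Longrightarrow> (r u has_real_derivative f (r u s)) (at s within T)"
  obtains E where "continuous_on (X \<times> X) E" "\<And>u v. 0 < E (u, v)"
    "\<And>u v. u \<in> X \<Longrightarrow> v \<in> X \<Longrightarrow> r u t - r v t = (r u 0 - r v 0) * E (u, v)"
proof (cases "0 \<le> t")
  case True
  have sub: "{0..t} \<subseteq> T"
  proof
    fix s assume "s \<in> {0..t}"
    then have "0 \<le> s" "s \<le> t"
      by auto
    then show "s \<in> T"
      by (rule mem_is_interval_1_I[OF T(1-3)])
  qed
  have "(r u has_real_derivative f (r u s)) (at s within {0..t})"
    if "u \<in> X" "s \<in> {0..t}" for u s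
    using that sub by (intro has_field_derivative_subset[OF flow]) auto
  from flow_difference_factor_forward[OF f X r0 True this]
  obtain E where "continuous_on (X \<times> X) E" "\<And>u v. 0 < E (u, v)"
    "\<And>u v. u \<in> X \<Longrightarrow> v \<in> X \<Longrightarrow> r u t - r v t = (r u 0 - r v 0) * E (u, v)"
    by blast
  then show thesis
    by (rule that)
next
  case False
  have sub: "uminus ` {0..-t} \<subseteq> T"
  proof
    fix s assume "s \<in> uminus ` {0..-t}"
    then have "t \<le> s" "s \<le> 0"
      by auto
    then show "s \<in> T"
      by (rule mem_is_interval_1_I[OF T(1,3,2)])
  qed
  have f': "(\<lambda>a. - f a) C1_differentiable_on UNIV"
    using f by (rule C1_differentiable_on_minus)
  have flow': "((\<lambda>s. r u (- s)) has_real_derivative - f (r u (- s))) (at s within {0..-t})"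
    if u: "u \<in> X" and s: "s \<in> {0..-t}" for u s
  proof -
    have "(r u has_real_derivative f (r u (- s))) (at (- s) within uminus ` {0..-t})"
      using sub s by (intro has_field_derivative_subset[OF flow[OF u] sub]) auto
    moreover have "(uminus has_real_derivative - 1) (at s within {0..-t})"
      by (auto intro!: derivative_eq_intros)
    ultimately show ?thesis
      using DERIV_image_chain[of "r u" _ uminus s] by (fastforce simp: o_def)
  qed
  have "continuous_on X (\<lambda>u. r u (- 0))" "0 \<le> - t"
    using r0 False by simp_all
  from flow_difference_factor_forward[OF f' X this flow']
  obtain E where "continuous_on (X \<times> X) E" "\<And>u v. 0 < E (u, v)"
    "\<And>u v. u \<in> X \<Longrightarrow> v \<in> X \<Longrightarrow>
       r u (- (- t)) - r v (- (- t)) = (r u (- 0) - r v (- 0)) * E (u, v)"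
    by blast
  then show thesis
    using that by simp
qed

section \<open>Proportional gradients\<close>

text \<open>
  The factor \<open>K\<close> only has to have a limit at \<open>u\<close>: it multiplies an increment of \<open>G\<close>, which is already
  of first order. The product rule would ask for differentiability of \<open>K\<close>, which the factor \<open>E\<close>
  of \<open>flow_difference_factor\<close> need not have when \<open>f\<close> is merely \<open>C\<^sup>1\<close>.
\<close>
lemma has_derivative_of_difference_factor:
  fixes G H :: "'a::real_normed_vector \<Rightarrow> real"
  assumes G: "(G has_derivative G') (at u)"
    and K: "(K \<longlongrightarrow> k) (at u)"
    and eq: "\<forall>\<^sub>F x in at u. H x - H u = (G x - G u) * K x"
  shows "(H has_derivative (\<lambda>x. k * G' x)) (at u)"
proof -
  have lin: "bounded_linear G'"
    and rem: "((\<lambda>x. (G x - G u - G' (x - u)) /\<^sub>R norm (x - u)) \<longlongrightarrow> 0) (at u)"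
    using G unfolding has_derivative_at_within by simp_all
  obtain B where B: "\<And>x. norm (G' x) \<le> norm x * B"
    using bounded_linear.bounded[OF lin] by blast
  have small: "((\<lambda>x. (K x - k) * (G' (x - u) / norm (x - u))) \<longlongrightarrow> 0) (at u)"
  proof (rule Lim_null_comparison)
    have "norm (G' (x - u) / norm (x - u)) \<le> B" if "x \<noteq> u" for x
      using B[of "x - u"] that by (simp add: field_simps)
    then have "norm ((K x - k) * (G' (x - u) / norm (x - u))) \<le> \<bar>K x - k\<bar> * B" if "x \<noteq> u" for x
      using that unfolding norm_mult by (simp add: mult_left_mono del: times_divide_eq_right)
    then show "\<forall>\<^sub>F x in at u. norm ((K x - k) * (G' (x - u) / norm (x - u))) \<le> \<bar>K x - k\<bar> * B"
      by (simp add: eventually_at_filter)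
    show "((\<lambda>x. \<bar>K x - k\<bar> * B) \<longlongrightarrow> 0) (at u)"
      by (rule tendsto_eq_intros K refl | simp)+
  qed
  have "((\<lambda>x. K x * ((G x - G u - G' (x - u)) /\<^sub>R norm (x - u))
            + (K x - k) * (G' (x - u) / norm (x - u))) \<longlongrightarrow> k * 0 + 0) (at u)"
    by (intro tendsto_intros K rem small)
  moreover have "\<forall>\<^sub>F x in at u. K x * ((G x - G u - G' (x - u)) /\<^sub>R norm (x - u))
            + (K x - k) * (G' (x - u) / norm (x - u))
            = (H x - H u - k * G' (x - u)) /\<^sub>R norm (x - u)"
    using eq
  proof eventually_elim
    case (elim x)
    show ?case
      unfolding elim by (simp add: divide_inverse algebra_simps)
  qed
  ultimately have "((\<lambda>x. (H x - H u - k * G' (x - u)) /\<^sub>R norm (x - u)) \<longlongrightarrow> 0) (at u)"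
    using tendsto_cong by force
  then show ?thesis
    unfolding has_derivative_at_within using bounded_linear_const_mult[OF lin] by simp
qed

text \<open>
  Near \<open>u\<close> the increments of the radial extensions differ by the factor \<open>E (sgn x, u)\<close>, which tends
  to \<open>E (u, u)\<close>. A gradient of \<open>h\<close> is thus obtained wherever \<open>g\<close> has one, so the lemma can also be
  applied with \<open>g\<close> and \<open>h\<close> exchanged.
\<close>
lemma has_sphere_gradient_scaled:
  assumes E: "continuous_on (S2 \<times> S2) E"
    and eq: "\<And>x y. x \<in> S2 \<Longrightarrow> y \<in> S2 \<Longrightarrow> h x - h y = (g x - g y) * E (x, y)"
    and grad: "has_sphere_gradient g u w"
  shows "has_sphere_gradient h u (E (u, u) *\<^sub>R w)"
proof -
  have u: "u \<in> S2" and G: "(radial_ext g has_derivative (\<lambda>x. x \<bullet> w)) (at u)"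
    using grad by (auto simp: has_sphere_gradient_def gderiv_def)
  have "u \<noteq> 0" and sgn_u: "sgn u = u"
    using u by (auto simp: sgn_div_norm)
  have "(sgn \<longlongrightarrow> u) (at u)"
    using tendsto_sgn[OF tendsto_ident_at \<open>u \<noteq> 0\<close>] sgn_u by simp
  then have "((\<lambda>x. (sgn x, u)) \<longlongrightarrow> (u, u)) (at u)"
    by (intro tendsto_intros)
  moreover have nz: "\<forall>\<^sub>F x in at u. sgn x \<in> S2"
    using eventually_neq_at_within[of 0 u UNIV] by eventually_elim (simp add: norm_sgn)
  then have "\<forall>\<^sub>F x in at u. (sgn x, u) \<in> S2 \<times> S2"
    using u by simp
  ultimately have K: "((\<lambda>x. E (sgn x, u)) \<longlongrightarrow> E (u, u)) (at u)"
    using u by (intro continuous_on_tendsto_compose[OF E]) auto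
  have "\<forall>\<^sub>F x in at u. radial_ext h x - radial_ext h u
            = (radial_ext g x - radial_ext g u) * E (sgn x, u)"
    using nz by eventually_elim (use eq[OF _ u] in \<open>simp add: radial_ext_def sgn_u\<close>)
  from has_derivative_of_difference_factor[OF G K this] show ?thesis
    using u by (simp add: has_sphere_gradient_def gderiv_def)
qed

section \<open>Integral curves of proportional fields\<close>

lemma continuous_antiderivative:
  fixes \<phi> :: "real \<Rightarrow> real"
  assumes "continuous_on UNIV \<phi>"
  obtains \<tau> where "\<tau> 0 = 0" "\<And>s. (\<tau> has_real_derivative \<phi> s) (at s)"
proof -
  define \<tau> where "\<tau> s = (LBINT y=0..s. \<phi> y)" for s :: real
  have "(\<tau> has_real_derivative \<phi> s) (at s)" for s
  proof -
    \<comment> \<open>An interval with both \<open>0\<close>, the base point of \<open>\<tau>\<close>, and \<open>s\<close> in its interior.\<close>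
    let ?a = "- \<bar>s\<bar> - 1" and ?b = "\<bar>s\<bar> + 1"
    have "((\<lambda>s. LBINT y=ereal 0..ereal s. \<phi> y) has_vector_derivative \<phi> s) (at s within {?a..?b})"
      by (rule interval_integral_FTC2) (auto intro: continuous_on_subset[OF assms])
    moreover have "at s within {?a..?b} = at s"
      by (rule at_within_interior) (auto simp: interior_atLeastAtMost_real)
    ultimately show ?thesis
      by (simp add: \<tau>_def[abs_def] has_real_derivative_iff_has_vector_derivative zero_ereal_def)
  qed
  moreover have "\<tau> 0 = 0"
    by (simp add: \<tau>_def zero_ereal_def)
  ultimately show thesis
    using that by blast
qed

text \<open>
  The new time \<open>\<tau>\<close> is an antiderivative of \<open>\<phi>\<close>, and \<open>\<sigma>\<close> is its inverse. The lower bound on \<open>\<phi>\<close> makes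
  \<open>\<tau>\<close> grow at least linearly in both directions, so that \<open>\<sigma>\<close> is defined on the whole line.
\<close>
lemma time_change:
  fixes \<phi> :: "real \<Rightarrow> real"
  assumes \<phi>: "continuous_on UNIV \<phi>" and c: "c > 0" "\<And>s. c \<le> \<phi> s"
  obtains \<sigma> where "\<sigma> 0 = 0" "\<And>s. (\<sigma> has_real_derivative inverse (\<phi> (\<sigma> s))) (at s)"
    "filterlim \<sigma> at_top at_top" "filterlim \<sigma> at_bot at_bot"
proof -
  obtain \<tau> where \<tau>0: "\<tau> 0 = 0" and \<tau>: "\<And>s. (\<tau> has_real_derivative \<phi> s) (at s)"
    using continuous_antiderivative[OF \<phi>] by blast
  have pos: "0 < \<phi> s" for s
    using c(1) c(2)[of s] by linarith
  have mono: "\<tau> a < \<tau> b" if "a < b" for a b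
    using DERIV_pos_imp_increasing[OF that] \<tau> pos by blast
  have inj: "inj \<tau>"
    by (rule linorder_injI) (use mono in fastforce)
  \<comment> \<open>Comparison with slope \<open>c\<close> forces \<open>\<tau>\<close> past every value \<open>y\<close> within distance \<open>\<bar>y\<bar> / c\<close> of \<open>0\<close>.\<close>
  have growth: "\<tau> a - c * a \<le> \<tau> b - c * b" if "a \<le> b" for a b
  proof (rule DERIV_nonneg_imp_nondecreasing[OF that])
    fix x
    have "((\<lambda>s. \<tau> s - c * s) has_real_derivative \<phi> x - c) (at x)"
      by (rule derivative_eq_intros \<tau> refl | simp)+
    then show "\<exists>y. ((\<lambda>s. \<tau> s - c * s) has_real_derivative y) (at x) \<and> 0 \<le> y"
      using c(2)[of x] by force
  qed
  have cont: "isCont \<tau> s" for s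
    using \<tau> DERIV_isCont by blast
  have "\<exists>s. \<tau> s = y" for y
  proof -
    let ?b = "\<bar>y\<bar> / c"
    have "\<tau> (- ?b) \<le> y" "y \<le> \<tau> ?b"
      using growth[of "- ?b" 0] growth[of 0 ?b] c(1) \<tau>0 by auto
    then show ?thesis
      using IVT[of \<tau> "- ?b" y ?b] cont c(1) by auto
  qed
  then have surj: "surj \<tau>"
    unfolding surj_def by metis
  define \<sigma> where "\<sigma> = inv \<tau>"
  have \<sigma>\<tau>: "\<sigma> (\<tau> s) = s" and \<tau>\<sigma>: "\<tau> (\<sigma> s) = s" for s
    using inj surj by (auto simp: \<sigma>_def surj_f_inv_f)
  have mono_iff: "\<tau> a \<le> \<tau> b \<longleftrightarrow> a \<le> b" for a b
    by (metis linorder_le_less_linear mono order_le_less less_le_not_le)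
  have "isCont \<sigma> (\<tau> (\<sigma> s))" for s
    by (rule isCont_inverse_function[of 1]) (auto simp: \<sigma>\<tau> cont)
  then have "isCont \<sigma> s" for s
    by (simp add: \<tau>\<sigma>)
  then have "(\<sigma> has_real_derivative inverse (\<phi> (\<sigma> s))) (at s)" for s
    using pos[of "\<sigma> s"]
    by (intro DERIV_inverse_function[OF \<tau>, where a = "s - 1" and b = "s + 1"]) (auto simp: \<tau>\<sigma>)
  moreover have "filterlim \<sigma> at_top at_top"
    unfolding filterlim_at_top
  proof
    fix Z show "\<forall>\<^sub>F x in at_top. Z \<le> \<sigma> x"
      using eventually_ge_at_top[of "\<tau> Z"] by eventually_elim (metis mono_iff \<tau>\<sigma>)
  qed
  moreover have "filterlim \<sigma> at_bot at_bot"
    unfolding filterlim_at_bot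
  proof
    fix Z show "\<forall>\<^sub>F x in at_bot. \<sigma> x \<le> Z"
      using eventually_le_at_bot[of "\<tau> Z"] by eventually_elim (metis mono_iff \<tau>\<sigma>)
  qed
  moreover have "\<sigma> 0 = 0"
    using \<sigma>\<tau>[of 0] \<tau>0 by simp
  ultimately show thesis
    using that by blast
qed

text \<open>
  The curve \<open>\<gamma> \<circ> \<sigma>\<close> has velocity \<open>\<mu>\<close> times the gradient of \<open>g\<close> if \<open>\<sigma>' = \<mu> (\<gamma> \<sigma>)\<close>, and this is
  \<open>time_change\<close> for \<open>\<phi> = 1 / \<mu> \<circ> \<gamma>\<close>; the bound on \<open>\<phi>\<close> comes from the maximum of \<open>\<mu>\<close> on the sphere.
\<close>
lemma integral_curve_time_change:
  assumes curve: "integral_curve g \<gamma>"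
    and \<mu>: "continuous_on S2 \<mu>" "\<And>u. u \<in> S2 \<Longrightarrow> 0 < \<mu> u"
    and grad: "\<And>u w. has_sphere_gradient g u w \<Longrightarrow> has_sphere_gradient h u (\<mu> u *\<^sub>R w)"
  obtains \<sigma> where "\<sigma> 0 = 0" "integral_curve h (\<gamma> \<circ> \<sigma>)"
    "filterlim \<sigma> at_top at_top" "filterlim \<sigma> at_bot at_bot"
proof -
  have \<gamma>: "\<gamma> s \<in> S2" for s
    using curve by (auto simp: integral_curve_def)
  have "\<exists>w. (\<gamma> has_vector_derivative w) (at s)" for s
    using curve by (auto simp: integral_curve_def)
  then have cont: "continuous_on UNIV \<gamma>"
    by (metis continuous_at_imp_continuous_on has_vector_derivative_continuous)
  obtain M where M: "M \<in> S2" "\<And>u. u \<in> S2 \<Longrightarrow> \<mu> u \<le> \<mu> M"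
    using continuous_attains_sup[OF compact_sphere _ \<mu>(1)] \<gamma> by (metis empty_iff)
  have cont\<phi>: "continuous_on UNIV (\<lambda>s. inverse (\<mu> (\<gamma> s)))"
    using \<mu>(2)[OF \<gamma>] \<gamma>
    by (intro continuous_on_inverse continuous_on_compose2[OF \<mu>(1) cont]) (auto simp: less_le)
  have bound: "inverse (\<mu> M) \<le> inverse (\<mu> (\<gamma> s))" for s
    using M(2)[OF \<gamma>] \<mu>(2)[OF \<gamma>] by (rule le_imp_inverse_le)
  have "0 < inverse (\<mu> M)"
    using \<mu>(2) M(1) by simp
  from time_change[OF cont\<phi> this bound] obtain \<sigma>
    where \<sigma>: "\<sigma> 0 = 0" "\<And>s. (\<sigma> has_real_derivative \<mu> (\<gamma> (\<sigma> s))) (at s)"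
      "filterlim \<sigma> at_top at_top" "filterlim \<sigma> at_bot at_bot"
    by (metis inverse_inverse_eq)
  have "integral_curve h (\<gamma> \<circ> \<sigma>)"
    unfolding integral_curve_def
  proof (intro allI conjI)
    fix s
    obtain w where w: "has_sphere_gradient g (\<gamma> (\<sigma> s)) w"
      "(\<gamma> has_vector_derivative w) (at (\<sigma> s))"
      using curve by (auto simp: integral_curve_def)
    have "((\<gamma> \<circ> \<sigma>) has_vector_derivative \<mu> (\<gamma> (\<sigma> s)) *\<^sub>R w) (at s)"
      by (rule vector_diff_chain_at[where f = \<sigma>, OF _ w(2)])
         (use \<sigma>(2) in \<open>simp add: has_real_derivative_iff_has_vector_derivative\<close>)
    then show "\<exists>w. has_sphere_gradient h ((\<gamma> \<circ> \<sigma>) s) w \<and> ((\<gamma> \<circ> \<sigma>) has_vector_derivative w) (at s)"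
      using grad[OF w(1)] by auto
  qed (use \<gamma> in simp)
  with \<sigma> show thesis
    using that by blast
qed

text \<open>
  These inclusions are one-sided so that they can be applied in both directions, once with
  multiplier \<open>\<mu>\<close> and once with its inverse.
\<close>
lemma
  assumes \<mu>: "continuous_on S2 \<mu>" "\<And>u. u \<in> S2 \<Longrightarrow> 0 < \<mu> u"
    and grad: "\<And>u w. has_sphere_gradient g u w \<Longrightarrow> has_sphere_gradient h u (\<mu> u *\<^sub>R w)"
  shows stable_manifold_subset: "stable_manifold g p \<subseteq> stable_manifold h p"
    and unstable_manifold_subset: "unstable_manifold g p \<subseteq> unstable_manifold h p"
    and critical_points_subset: "critical_points g \<subseteq> critical_points h"
proof -
  have "\<exists>\<delta>. integral_curve h \<delta> \<and> \<delta> 0 = \<gamma> 0 \<and> ((\<gamma> \<longlongrightarrow> p) at_top \<longrightarrow> (\<delta> \<longlongrightarrow> p) at_top)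
            \<and> ((\<gamma> \<longlongrightarrow> p) at_bot \<longrightarrow> (\<delta> \<longlongrightarrow> p) at_bot)" if curve: "integral_curve g \<gamma>" for \<gamma>
  proof -
    obtain \<sigma> where "\<sigma> 0 = 0" "integral_curve h (\<gamma> \<circ> \<sigma>)"
      "filterlim \<sigma> at_top at_top" "filterlim \<sigma> at_bot at_bot"
      using integral_curve_time_change[OF curve \<mu> grad] by blast
    then show ?thesis
      by (intro exI[of _ "\<gamma> \<circ> \<sigma>"]) (auto simp: o_def intro: filterlim_compose)
  qed
  then show "stable_manifold g p \<subseteq> stable_manifold h p"
    "unstable_manifold g p \<subseteq> unstable_manifold h p"
    unfolding stable_manifold_def unstable_manifold_def by blast+
  show "critical_points g \<subseteq> critical_points h"
    using grad[of _ 0] by (auto simp: critical_points_def)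
qed

lemma morse_smale_complex_eq_if_difference_factor:
  assumes E: "continuous_on (S2 \<times> S2) E" "\<And>x y. 0 < E (x, y)"
    and eq: "\<And>x y. x \<in> S2 \<Longrightarrow> y \<in> S2 \<Longrightarrow> h x - h y = (g x - g y) * E (x, y)"
  shows "morse_smale_complex h = morse_smale_complex g"
proof -
  have E': "continuous_on (S2 \<times> S2) (\<lambda>p. inverse (E p))"
    using E by (intro continuous_on_inverse) (auto simp: less_le)
  have eq': "g x - g y = (h x - h y) * inverse (E (x, y))" if "x \<in> S2" "y \<in> S2" for x y
    using eq[OF that] E(2)[of x y] by (simp add: field_simps)
  have diag: "continuous_on S2 (\<lambda>u. E (u, u))"
    by (rule continuous_on_compose2[OF E(1)]) (auto intro!: continuous_intros)
  have diag': "continuous_on S2 (\<lambda>u. inverse (E (u, u)))"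
    using E(2) by (intro continuous_on_inverse diag) (auto simp: less_le)
  note grad = has_sphere_gradient_scaled[OF E(1) eq]
  note grad' = has_sphere_gradient_scaled[OF E' eq']
  have pos: "0 < E (u, u)" "0 < inverse (E (u, u))" for u
    using E(2) by auto
  have "stable_manifold h p = stable_manifold g p"
    "unstable_manifold h p = unstable_manifold g p" for p
    using stable_manifold_subset[OF diag pos(1) grad] stable_manifold_subset[OF diag' pos(2) grad']
      unstable_manifold_subset[OF diag pos(1) grad] unstable_manifold_subset[OF diag' pos(2) grad']
    by blast+
  moreover have "critical_points h = critical_points g"
    using critical_points_subset[OF diag pos(1) grad] critical_points_subset[OF diag' pos(2) grad']
    by blast
  ultimately show ?thesis
    by (simp add: morse_smale_complex_def)
qed

section \<open>Invariance of the Morse-Smale complex\<close>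

lemma sphere_Ck_Suc_imp_continuous_on:
  assumes "sphere_Ck (Suc k) g"
  shows "continuous_on S2 g"
proof -
  have "continuous_on (- {0}) (radial_ext g)"
    using assms
    by (intro continuous_at_imp_continuous_on ballI differentiable_imp_continuous_within)
       (simp add: sphere_Ck_def)
  then have "continuous_on S2 (radial_ext g)"
    by (rule continuous_on_subset) auto
  then show ?thesis
    by (rule continuous_on_eq) (simp add: radial_ext_def sgn_div_norm)
qed

theorem corollary2:
  fixes f :: "real \<Rightarrow> real" and r :: "real^3 \<Rightarrow> real \<Rightarrow> real" and T :: "real set"
  assumes f_C1: "f C1_differentiable_on UNIV"
    and interval: "is_interval T" "0 \<in> T"
    and flow: "\<And>u t. u \<in> S2 \<Longrightarrow> t \<in> T \<Longrightarrow> (r u has_real_derivative f (r u t)) (at t within T)"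
    and initial_C3: "sphere_Ck 3 (\<lambda>u. r u 0)"
    and initial_morse_smale: "morse_smale (\<lambda>u. r u 0)"
  shows "\<forall>t\<in>T. morse_smale_complex (\<lambda>u. r u t) = morse_smale_complex (\<lambda>u. r u 0)"
proof
  fix t assume t: "t \<in> T"
  have "continuous_on S2 (\<lambda>u. r u 0)"
    using initial_C3 sphere_Ck_Suc_imp_continuous_on[of 2] by (simp add: numeral_3_eq_3)
  from flow_difference_factor[OF f_C1 compact_sphere this interval t flow] obtain E
    where "continuous_on (S2 \<times> S2) E" "\<And>u v. 0 < E (u, v)"
      "\<And>u v. u \<in> S2 \<Longrightarrow> v \<in> S2 \<Longrightarrow> r u t - r v t = (r u 0 - r v 0) * E (u, v)"
    by metis
  then show "morse_smale_complex (\<lambda>u. r u t) = morse_smale_complex (\<lambda>u. r u 0)"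
    by (rule morse_smale_complex_eq_if_difference_factor)
qed

end
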